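(* For any matroid $M$ on a finite ground set $E$, $$F(M,\mathbf{x})=\sum_{B\in\mathcal{B}(M)}F(P_B,\gamma_B,\mathbf{x}),$$ where $\gamma_B$ is any strict labelling of the poset $P_B$.
   Context: For a matroid $M$ on finite ground set $E$ with bases $\mathcal{B}(M)$ and $f:E\to\mathbb{P}=\{1,2,\ldots\}$, $f$ is $M$-generic if the minimum of $f(B)=\sum_{e\in B}f(e)$ over bases is attained by a unique base; $F(M,\mathbf{x})=\sum_{f\ M\text{-generic}}\prod_{e\in E}x_{f(e)}$. For a base $B$, $P_B$ is the poset on $E$ in which $e<e'$ if and only if $e\in B$, $e'\notin B$ and $(B\setminus\{e\})\cup\{e'\}$ is a base of $M$ (a poset of height at most one, elements of $B$ below elements of $E\setminus B$). A labelled poset $(P,\gamma)$ on $n$ elements is a poset with a bijection $\gamma:P\to\{1,\ldots,n\}$; $\gamma$ is strict if $\gamma(p)>\gamma(p')$ whenever $p<p'$. A $(P,\gamma)$-partition is $f:P\to\mathbb{P}$ with $f(p)\le f(p')$ whenever $p\le p'$, and $f(p)<f(p')$ whenever $p\le p'$ and $\gamma(p)>\gamma(p')$. $F(P,\gamma,\mathbf{x})=\sum_f\prod_{p\in P}x_{f(p)}$, summed over all $(P,\gamma)$-partitions $f$. *)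

theory Defs
  imports Complex_Main "HOL-Library.Poly_Mapping" "HOL-Library.FuncSet"
    "HOL-Library.Function_Algebras"
begin

text \<open>A monomial in $x_0, x_1, \dots$ is its exponent vector, a polynomial is a finitely supported
  function on monomials, and a formal power series is an arbitrary one. Power series are added
  coefficientwise. (The pointwise product on functions is not the product of power series; it is not
  used.) The variable $x_0$ never occurs, as all maps take values in \<open>{1..}\<close>.\<close>

type_synonym polyn = "(nat \<Rightarrow>\<^sub>0 nat) \<Rightarrow>\<^sub>0 int"
type_synonym power_series = "(nat \<Rightarrow>\<^sub>0 nat) \<Rightarrow> int"

definition X :: "nat \<Rightarrow> polyn" where
  "X i = Poly_Mapping.single (Poly_Mapping.single i 1) 1"

text \<open>The sum of a possibly infinite family of polynomials in which every monomial occurs only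
  finitely often (see \<open>finite_monomial_occurrences\<close> for the families used here).\<close>

definition formal_sum :: "('i \<Rightarrow> polyn) \<Rightarrow> 'i set \<Rightarrow> power_series" where
  "formal_sum g I = (\<lambda>m. \<Sum>i | i \<in> I \<and> Poly_Mapping.lookup (g i) m \<noteq> 0. Poly_Mapping.lookup (g i) m)"

lemma prod_X:
  "(\<Prod>e\<in>E. X (f e)) = Poly_Mapping.single (\<Sum>e\<in>E. Poly_Mapping.single (f e) 1) 1"
  by (induction E rule: infinite_finite_induct) (simp_all add: X_def mult_single)

lemma finite_monomial_occurrences:
  assumes "finite E" and "I \<subseteq> E \<rightarrow>\<^sub>E {1..}"
  shows "finite {f \<in> I. Poly_Mapping.lookup (\<Prod>e\<in>E. X (f e)) m \<noteq> 0}"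
proof (rule finite_subset)
  show "finite (E \<rightarrow>\<^sub>E Poly_Mapping.keys m)"
    using assms(1) by (intro finite_PiE) auto
  show "{f \<in> I. Poly_Mapping.lookup (\<Prod>e\<in>E. X (f e)) m \<noteq> 0} \<subseteq> E \<rightarrow>\<^sub>E Poly_Mapping.keys m"
  proof
    fix f assume f: "f \<in> {f \<in> I. Poly_Mapping.lookup (\<Prod>e\<in>E. X (f e)) m \<noteq> 0}"
    then have m: "m = (\<Sum>e\<in>E. Poly_Mapping.single (f e) 1)"
      by (auto simp: prod_X lookup_single when_def split: if_splits)
    have "f e \<in> Poly_Mapping.keys m" if "e \<in> E" for e
    proof -
      have "Poly_Mapping.lookup m (f e) = (\<Sum>d\<in>E. Poly_Mapping.lookup (Poly_Mapping.single (f d) 1) (f e))"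
        by (simp add: m lookup_sum)
      also have "\<dots> \<ge> Poly_Mapping.lookup (Poly_Mapping.single (f e) (1::nat)) (f e)"
        using assms(1) that by (intro member_le_sum) auto
      finally show ?thesis by (simp add: in_keys_iff)
    qed
    then show "f \<in> E \<rightarrow>\<^sub>E Poly_Mapping.keys m"
      using f assms(2) by (auto simp: PiE_iff)
  qed
qed

locale matroid =
  fixes E :: "'a set" and \<B> :: "'a set set"
  assumes finite_ground: "finite E"
    and base_subset: "B \<in> \<B> \<Longrightarrow> B \<subseteq> E"
    and base_exists: "\<B> \<noteq> {}"
    and base_exchange: "\<lbrakk>B \<in> \<B>; B' \<in> \<B>; e \<in> B - B'\<rbrakk> \<Longrightarrow> \<exists>e' \<in> B' - B. insert e' (B - {e}) \<in> \<B>"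

text \<open>Maps $E \to \{1, 2, \dots\}$ are elements of \<open>E \<rightarrow>\<^sub>E {1..}\<close>, so that each is counted once.\<close>

definition matroid_generic :: "'a set set \<Rightarrow> ('a \<Rightarrow> nat) \<Rightarrow> bool" where
  "matroid_generic \<B> f \<longleftrightarrow> (\<exists>!B. B \<in> \<B> \<and> (\<forall>B'\<in>\<B>. sum f B \<le> sum f B'))"

definition F_matroid :: "'a set \<Rightarrow> 'a set set \<Rightarrow> power_series" where
  "F_matroid E \<B> = formal_sum (\<lambda>f. \<Prod>e\<in>E. X (f e)) {f \<in> E \<rightarrow>\<^sub>E {1..}. matroid_generic \<B> f}"

text \<open>A poset on \<open>P\<close> is given by its reflexive order relation.\<close>

definition base_poset :: "'a set \<Rightarrow> 'a set set \<Rightarrow> 'a set \<Rightarrow> ('a \<times> 'a) set" where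
  "base_poset E \<B> B = Id_on E \<union>
     {(e, e'). e \<in> B \<and> e' \<in> E - B \<and> (B - {e}) \<union> {e'} \<in> \<B>}"

lemma (in matroid) partial_order_on_base_poset:
  assumes "B \<in> \<B>"
  shows "partial_order_on E (base_poset E \<B> B)"
  using base_subset[OF assms]
  by (auto simp: base_poset_def partial_order_on_def preorder_on_def refl_on_def
      intro!: transI antisymI)

definition labelling :: "'a set \<Rightarrow> ('a \<Rightarrow> nat) \<Rightarrow> bool" where
  "labelling P \<gamma> \<longleftrightarrow> bij_betw \<gamma> P {1..card P}"

definition strict_labelling :: "'a set \<Rightarrow> ('a \<times> 'a) set \<Rightarrow> ('a \<Rightarrow> nat) \<Rightarrow> bool" where
  "strict_labelling P r \<gamma> \<longleftrightarrow>
     labelling P \<gamma> \<and> (\<forall>(p, p') \<in> r. p \<noteq> p' \<longrightarrow> \<gamma> p > \<gamma> p')"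

definition P_partition ::
    "'a set \<Rightarrow> ('a \<times> 'a) set \<Rightarrow> ('a \<Rightarrow> nat) \<Rightarrow> ('a \<Rightarrow> nat) \<Rightarrow> bool" where
  "P_partition P r \<gamma> f \<longleftrightarrow> f \<in> P \<rightarrow>\<^sub>E {1..} \<and>
     (\<forall>(p, p') \<in> r. f p \<le> f p' \<and> (\<gamma> p > \<gamma> p' \<longrightarrow> f p < f p'))"

definition F_poset :: "'a set \<Rightarrow> ('a \<times> 'a) set \<Rightarrow> ('a \<Rightarrow> nat) \<Rightarrow> power_series" where
  "F_poset P r \<gamma> = formal_sum (\<lambda>f. \<Prod>p\<in>P. X (f p)) {f. P_partition P r \<gamma> f}"

end

theory Submission
  imports Defs
begin

text \<open>A map is a strict \<open>P\<^sub>B\<close>-partition iff \<open>B\<close> is lighter than all bases obtained from it by a single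
  exchange. Local minimality of this kind is global: let \<open>B'\<close> be a base of minimal weight other
  than \<open>B\<close>, as close to \<open>B\<close> as possible. Exchanging from \<open>B\<close> towards \<open>B'\<close> shows that every element
  of \<open>B - B'\<close> is lighter than some element of \<open>B' - B\<close>, and exchanging from \<open>B'\<close> towards \<open>B\<close> shows
  that every element of \<open>B' - B\<close> is lighter than some element of \<open>B - B'\<close>. Hence the finite
  symmetric difference has no heaviest element, which is absurd. So the generic maps are
  partitioned by their unique minimal base into the sets of \<open>P\<^sub>B\<close>-partitions.\<close>

text \<open>For each monomial \<open>m\<close>, the indices contributing to its coefficient split
  into finitely many disjoint sets. Their finiteness matters because \<open>sum\<close> over an
  infinite set is 0 by convention.\<close>

lemma formal_sum_UN_disjoint:
  assumes "finite J"
    and "\<And>j m. j \<in> J \<Longrightarrow> finite {i \<in> A j. Poly_Mapping.lookup (g i) m \<noteq> 0}"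
    and "\<And>j k. j \<in> J \<Longrightarrow> k \<in> J \<Longrightarrow> j \<noteq> k \<Longrightarrow> A j \<inter> A k = {}"
  shows "formal_sum g (\<Union>j\<in>J. A j) = (\<Sum>j\<in>J. formal_sum g (A j))"
proof
  fix m
  let ?S = "\<lambda>j. {i \<in> A j. Poly_Mapping.lookup (g i) m \<noteq> 0}"
  have "{i. i \<in> (\<Union>j\<in>J. A j) \<and> Poly_Mapping.lookup (g i) m \<noteq> 0} = (\<Union>j\<in>J. ?S j)"
    by auto
  then have "formal_sum g (\<Union>j\<in>J. A j) m = (\<Sum>i\<in>(\<Union>j\<in>J. ?S j). Poly_Mapping.lookup (g i) m)"
    by (simp add: formal_sum_def)
  also have "\<dots> = (\<Sum>j\<in>J. \<Sum>i\<in>?S j. Poly_Mapping.lookup (g i) m)"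
    using assms by (intro sum.UNION_disjoint) blast+
  also have "\<dots> = (\<Sum>j\<in>J. formal_sum g (A j) m)"
    by (simp add: formal_sum_def)
  also have "\<dots> = (\<Sum>j\<in>J. formal_sum g (A j)) m"
    by (induction J rule: infinite_finite_induct) simp_all
  finally show "formal_sum g (\<Union>j\<in>J. A j) m = (\<Sum>j\<in>J. formal_sum g (A j)) m" .
qed

text \<open>A strict labelling descends along every strict relation, so each of them demands a
  strict inequality, while reflexive pairs demand nothing. The resulting condition no longer
  mentions \<gamma>, which is why any strict labelling will do.\<close>

lemma P_partition_strict_labelling:
  assumes "strict_labelling P r \<gamma>"
  shows "P_partition P r \<gamma> f \<longleftrightarrow>
    f \<in> P \<rightarrow>\<^sub>E {1..} \<and> (\<forall>(p, p') \<in> r. p \<noteq> p' \<longrightarrow> f p < f p')"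
  using assms unfolding P_partition_def strict_labelling_def by fastforce

definition minimal_base :: "'a set set \<Rightarrow> ('a \<Rightarrow> nat) \<Rightarrow> 'a set \<Rightarrow> bool" where
  "minimal_base \<B> f B \<longleftrightarrow> B \<in> \<B> \<and> (\<forall>B'\<in>\<B>. sum f B \<le> sum f B')"

lemma matroid_generic_iff: "matroid_generic \<B> f \<longleftrightarrow> (\<exists>!B. minimal_base \<B> f B)"
  by (simp add: matroid_generic_def minimal_base_def)

context matroid
begin

lemma finite_base: "B \<in> \<B> \<Longrightarrow> finite B"
  using base_subset finite_ground finite_subset by blast

lemma finite_bases: "finite \<B>"
  using finite_ground base_subset by (intro finite_subset[of \<B> "Pow E"]) auto

text \<open>Additive form, which avoids truncated subtraction on \<open>nat\<close>.\<close>

lemma sum_exchange: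
  fixes f :: "'a \<Rightarrow> nat"
  assumes "B \<in> \<B>" "e \<in> B" "e' \<notin> B"
  shows "sum f (insert e' (B - {e})) + f e = sum f B + f e'"
  using assms sum.remove[OF finite_base[OF assms(1)] assms(2), of f] finite_base
  by (simp add: sum.insert_if)

lemma minimal_base_exists: "\<exists>B. minimal_base \<B> f B"
  using base_exists ex_has_least_nat[of "\<lambda>B. B \<in> \<B>" _ "sum f"]
  unfolding minimal_base_def by blast

lemma minimal_base_eq_local_minimum:
  fixes f :: "'a \<Rightarrow> nat"
  assumes B: "B \<in> \<B>"
    and local_min: "\<And>e e'. e \<in> B \<Longrightarrow> e' \<notin> B \<Longrightarrow> insert e' (B - {e}) \<in> \<B> \<Longrightarrow> f e < f e'"
    and "minimal_base \<B> f B'"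
  shows "B' = B"
proof (rule ccontr)
  assume "B' \<noteq> B"
  then obtain C where C: "minimal_base \<B> f C" "C \<noteq> B"
    and closest: "\<And>D. minimal_base \<B> f D \<Longrightarrow> D \<noteq> B \<Longrightarrow> card (C - B) \<le> card (D - B)"
    using assms(3) ex_has_least_nat[of "\<lambda>D. minimal_base \<B> f D \<and> D \<noteq> B" B' "\<lambda>D. card (D - B)"]
    by blast
  have C_base: "C \<in> \<B>" and C_min: "\<And>D. D \<in> \<B> \<Longrightarrow> sum f C \<le> sum f D"
    using C(1) by (auto simp: minimal_base_def)
  have lighter_than_C: "\<exists>e'\<in>C - B. f e < f e'" if "e \<in> B - C" for e
    using base_exchange[OF B C_base that] local_min that by blast
  have lighter_than_B: "\<exists>e'\<in>B - C. f e < f e'" if e: "e \<in> C - B" for e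
  proof -
    obtain e' where e': "e' \<in> B - C" and D: "insert e' (C - {e}) \<in> \<B>"
      using base_exchange[OF C_base B e] by blast
    let ?D = "insert e' (C - {e})"
    have weight: "sum f ?D + f e = sum f C + f e'"
      using e e' by (intro sum_exchange[OF C_base]) auto
    \<comment> \<open>With equal weights, \<open>?D\<close> would be minimal too. If it is
      \<open>B\<close>, then \<open>C\<close> arises from \<open>B\<close> by the reverse exchange
      and \<open>local_min\<close> gives \<open>f e' < f e\<close>; otherwise \<open>?D\<close> is
      closer to \<open>B\<close> than \<open>C\<close> is.\<close>
    have "f e \<noteq> f e'"
    proof
      assume eq: "f e = f e'"
      show False
      proof (cases "?D = B")
        case True
        then have "insert e (B - {e'}) = C"
          using e e' by auto
        then show False
          using local_min[of e' e] e e' C_base eq by auto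
      next
        case False
        have "minimal_base \<B> f ?D"
          using weight eq D C_min by (simp add: minimal_base_def)
        then have "card (C - B) \<le> card (?D - B)"
          using closest False by blast
        moreover have "?D - B \<subset> C - B"
          using e e' by auto
        ultimately show False
          using psubset_card_mono[of "C - B" "?D - B"] finite_base[OF C_base] by auto
      qed
    qed
    \<comment> \<open>Minimality of \<open>C\<close> gives \<open>f e \<le> f e'\<close>, and
      equality has just been excluded.\<close>
    then show ?thesis
      using C_min[OF D] weight e' by (intro bexI[of _ e']) auto
  qed
  let ?S = "(B - C) \<union> (C - B)"
  have "finite ?S" "?S \<noteq> {}"
    using B C_base C(2) finite_base by auto
  then have "Max (f ` ?S) \<in> f ` ?S"
    by (intro Max_in) auto
  then obtain e where e: "e \<in> ?S" "f e = Max (f ` ?S)"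
    by (elim imageE) simp
  then obtain e' where "e' \<in> ?S" "f e < f e'"
    using lighter_than_B lighter_than_C by blast
  moreover have "f e' \<le> f e" if "e' \<in> ?S" for e'
    using \<open>finite ?S\<close> that e(2) by simp
  ultimately show False
    by fastforce
qed

text \<open>The strict relations of the poset are exactly the single exchanges out of
  \<open>B\<close>, so the partition condition is local minimality. The right-hand side makes
  \<open>B\<close> the only minimal base, hence determined by \<open>f\<close>.\<close>

lemma P_partition_base_poset_iff:
  assumes B: "B \<in> \<B>" and "strict_labelling E (base_poset E \<B> B) \<gamma>"
  shows "P_partition E (base_poset E \<B> B) \<gamma> f \<longleftrightarrow>
    f \<in> E \<rightarrow>\<^sub>E {1..} \<and> (\<forall>B'. minimal_base \<B> f B' \<longleftrightarrow> B' = B)"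
proof -
  have "(\<forall>(p, p') \<in> base_poset E \<B> B. p \<noteq> p' \<longrightarrow> f p < f p') \<longleftrightarrow>
      (\<forall>e e'. e \<in> B \<longrightarrow> e' \<notin> B \<longrightarrow> insert e' (B - {e}) \<in> \<B> \<longrightarrow> f e < f e')"
  proof -
    \<comment> \<open>\<open>base_poset\<close> also asks for membership in \<open>E\<close>; this
      is automatic once the exchanged set is a base.\<close>
    have "e' \<in> E" if "insert e' (B - {e}) \<in> \<B>" for e e'
      using base_subset[OF that] by simp
    then have "(e, e') \<in> base_poset E \<B> B \<and> e \<noteq> e' \<longleftrightarrow>
        e \<in> B \<and> e' \<notin> B \<and> insert e' (B - {e}) \<in> \<B>" for e e'
      by (auto simp: base_poset_def)
    then show ?thesis
      unfolding Ball_def split_paired_All prod.case by meson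
  qed
  also have "\<dots> \<longleftrightarrow> (\<forall>B'. minimal_base \<B> f B' \<longleftrightarrow> B' = B)"
  proof
    assume "\<forall>e e'. e \<in> B \<longrightarrow> e' \<notin> B \<longrightarrow> insert e' (B - {e}) \<in> \<B> \<longrightarrow> f e < f e'"
    then show "\<forall>B'. minimal_base \<B> f B' \<longleftrightarrow> B' = B"
      using minimal_base_eq_local_minimum[OF B] minimal_base_exists by metis
  next
    assume unique: "\<forall>B'. minimal_base \<B> f B' \<longleftrightarrow> B' = B"
    show "\<forall>e e'. e \<in> B \<longrightarrow> e' \<notin> B \<longrightarrow> insert e' (B - {e}) \<in> \<B> \<longrightarrow> f e < f e'"
    proof (intro allI impI)
      fix e e' assume e: "e \<in> B" "e' \<notin> B" and D: "insert e' (B - {e}) \<in> \<B>"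
      \<comment> \<open>The exchanged base contains \<open>e'\<close>, so it differs from the only
        minimal base \<open>B\<close>.\<close>
      have "\<not> minimal_base \<B> f (insert e' (B - {e}))"
        using unique e by auto
      moreover have "minimal_base \<B> f B"
        using unique by blast
      ultimately have "sum f B < sum f (insert e' (B - {e}))"
        using D unfolding minimal_base_def by (meson le_trans not_le)
      then show "f e < f e'"
        using sum_exchange[OF B e, of f] by linarith
    qed
  qed
  finally show ?thesis
    unfolding P_partition_strict_labelling[OF assms(2)] by (rule arg_cong)
qed

end

theorem theorem5p2:
  fixes E :: "'a set" and \<B> :: "'a set set" and \<gamma> :: "'a set \<Rightarrow> 'a \<Rightarrow> nat"
  assumes "matroid E \<B>"
    and "\<And>B. B \<in> \<B> \<Longrightarrow> strict_labelling E (base_poset E \<B> B) (\<gamma> B)"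
  shows "F_matroid E \<B> = (\<Sum>B\<in>\<B>. F_poset E (base_poset E \<B> B) (\<gamma> B))"
proof -
  interpret matroid E \<B> by fact
  let ?A = "\<lambda>B. {f. P_partition E (base_poset E \<B> B) (\<gamma> B) f}"
  note partition_iff = P_partition_base_poset_iff[OF _ assms(2)]
  have "{f \<in> E \<rightarrow>\<^sub>E {1..}. matroid_generic \<B> f} = (\<Union>B\<in>\<B>. ?A B)"
  proof (intro set_eqI iffI)
    fix f assume "f \<in> {f \<in> E \<rightarrow>\<^sub>E {1..}. matroid_generic \<B> f}"
    then obtain B where "f \<in> E \<rightarrow>\<^sub>E {1..}" and "\<forall>B'. minimal_base \<B> f B' \<longleftrightarrow> B' = B"
      unfolding matroid_generic_iff by blast
    moreover from this have "B \<in> \<B>"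
      by (auto simp: minimal_base_def)
    ultimately show "f \<in> (\<Union>B\<in>\<B>. ?A B)"
      using partition_iff by blast
  next
    fix f assume "f \<in> (\<Union>B\<in>\<B>. ?A B)"
    then show "f \<in> {f \<in> E \<rightarrow>\<^sub>E {1..}. matroid_generic \<B> f}"
      using partition_iff by (auto simp: matroid_generic_iff)
  qed
  moreover have "formal_sum (\<lambda>f. \<Prod>e\<in>E. X (f e)) (\<Union>B\<in>\<B>. ?A B)
      = (\<Sum>B\<in>\<B>. formal_sum (\<lambda>f. \<Prod>e\<in>E. X (f e)) (?A B))"
  proof (rule formal_sum_UN_disjoint[OF finite_bases])
    show "finite {f \<in> ?A B. Poly_Mapping.lookup (\<Prod>e\<in>E. X (f e)) m \<noteq> 0}" for B m
      by (rule finite_monomial_occurrences[OF finite_ground]) (auto simp: P_partition_def)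
    \<comment> \<open>A common element would have both \<open>B\<close> and \<open>C\<close> as its
      only minimal base.\<close>
    show "?A B \<inter> ?A C = {}" if "B \<in> \<B>" "C \<in> \<B>" "B \<noteq> C" for B C
      using that partition_iff by auto
  qed
  ultimately show ?thesis
    unfolding F_matroid_def F_poset_def by simp
qed

end
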